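(* For every integer $k\ge 1$ there exists $N_0(k)$ such that the following holds. If $G$ is a $kK_3$-free $4$-partite graph with parts of sizes $n_1\ge n_2\ge n_3\ge n_4\ge 6k^2$ and $n_1+n_2+n_3+n_4\ge N_0(k)$, then $$e(G)\le g_k(n_1,n_2,n_3,n_4).$$ In other words, $\mathrm{ex}(K_{n_1,n_2,n_3,n_4},\,kK_3)\le g_k(n_1,n_2,n_3,n_4)$ for all such $n_1,n_2,n_3,n_4$.
   Context: All graphs are finite and simple, and $e(G)$ denotes the number of edges of $G$. A $4$-partite graph with parts $V_1,V_2,V_3,V_4$ is a graph whose vertex set is the disjoint union of $V_1,\dots,V_4$ and which has no edge inside any $V_i$. $K_{n_1,n_2,n_3,n_4}$ is the complete $4$-partite graph with parts of sizes $n_1,\dots,n_4$. $kK_3$ denotes $k$ vertex-disjoint copies of the triangle $K_3$. A graph $G$ is $F$-free if $G$ does not contain $F$ as a (not necessarily induced) subgraph. $\mathrm{ex}(H,F)$ is the maximum number of edges in an $F$-free subgraph of $H$. For $k\ge 1$ and positive integers $n_1\ge n_2\ge n_3\ge n_4$, define $$g_k(n_1,n_2,n_3,n_4):=\max\{(n_1+n_4)(n_2+n_3)+(k-1)n_1,\; n_1(n_2+n_3+n_4)+(k-1)(n_2+n_3)\}.$$ *)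

theory Defs
  imports Main
begin

record 'a sgraph =
  verts :: "'a set"
  edges :: "'a set set"

definition simple_graph :: "'a sgraph \<Rightarrow> bool" where
  "simple_graph G \<longleftrightarrow>
     finite (verts G) \<and> (\<forall>e\<in>edges G. e \<subseteq> verts G \<and> card e = 2)"

definition num_edges :: "'a sgraph \<Rightarrow> nat" where
  "num_edges G = card (edges G)"

definition subgraph :: "'a sgraph \<Rightarrow> 'a sgraph \<Rightarrow> bool" where
  "subgraph G H \<longleftrightarrow> simple_graph G \<and> verts G \<subseteq> verts H \<and> edges G \<subseteq> edges H"

(* H contains F up to isomorphism: the image of F under f is a (not necessarily induced) subgraph. *)
definition contains_copy :: "'a sgraph \<Rightarrow> 'b sgraph \<Rightarrow> bool" where
  "contains_copy H F \<longleftrightarrow>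
     (\<exists>f. inj_on f (verts F) \<and> f ` verts F \<subseteq> verts H \<and> (\<forall>e\<in>edges F. f ` e \<in> edges H))"

definition is_free :: "'b sgraph \<Rightarrow> 'a sgraph \<Rightarrow> bool" where
  "is_free F G \<longleftrightarrow> \<not> contains_copy G F"

(* Max of an empty set is unspecified; the set below is nonempty whenever F has a vertex,
   because the graph without vertices is then an F-free subgraph of H. *)
definition ex_num :: "'a sgraph \<Rightarrow> 'b sgraph \<Rightarrow> nat" where
  "ex_num H F = Max {num_edges G | G. subgraph G H \<and> is_free F G}"

definition complete_graph :: "nat \<Rightarrow> nat sgraph" where
  "complete_graph n =
     \<lparr>verts = {..<n}, edges = {{a, b} | a b. a < n \<and> b < n \<and> a \<noteq> b}\<rparr>"

definition disjoint_copies :: "nat \<Rightarrow> 'a sgraph \<Rightarrow> (nat \<times> 'a) sgraph" where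
  "disjoint_copies k F =
     \<lparr>verts = {..<k} \<times> verts F, edges = {Pair i ` e | i e. i < k \<and> e \<in> edges F}\<rparr>"

abbreviation kK3 :: "nat \<Rightarrow> (nat \<times> nat) sgraph" where
  "kK3 k \<equiv> disjoint_copies k (complete_graph 3)"

(* The i-th part is {(i, a) | a < ns ! i}. *)
definition complete_multipartite :: "nat list \<Rightarrow> (nat \<times> nat) sgraph" where
  "complete_multipartite ns =
     \<lparr>verts = {(i, a). i < length ns \<and> a < ns ! i},
      edges = {{(i, a), (j, b)} | i a j b.
        i < length ns \<and> a < ns ! i \<and> j < length ns \<and> b < ns ! j \<and> i \<noteq> j}\<rparr>"

definition four_partite ::
  "'a sgraph \<Rightarrow> 'a set \<Rightarrow> 'a set \<Rightarrow> 'a set \<Rightarrow> 'a set \<Rightarrow> bool" where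
  "four_partite G V1 V2 V3 V4 \<longleftrightarrow>
     simple_graph G \<and>
     verts G = V1 \<union> V2 \<union> V3 \<union> V4 \<and>
     V1 \<inter> V2 = {} \<and> V1 \<inter> V3 = {} \<and> V1 \<inter> V4 = {} \<and>
     V2 \<inter> V3 = {} \<and> V2 \<inter> V4 = {} \<and> V3 \<inter> V4 = {} \<and>
     (\<forall>e\<in>edges G. \<not> e \<subseteq> V1 \<and> \<not> e \<subseteq> V2 \<and> \<not> e \<subseteq> V3 \<and> \<not> e \<subseteq> V4)"

(* Natural-number subtraction: only meaningful for k \<ge> 1. *)
definition g_bound :: "nat \<Rightarrow> nat \<Rightarrow> nat \<Rightarrow> nat \<Rightarrow> nat \<Rightarrow> nat" where
  "g_bound k n1 n2 n3 n4 =
     max ((n1 + n4) * (n2 + n3) + (k - 1) * n1)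
         (n1 * (n2 + n3 + n4) + (k - 1) * (n2 + n3))"

end

theory Submission
  imports Defs
begin

text \<open>Induction on k. Suppose first that some vertex v has more than 3(k - 1) disjoint edges in its
  neighbourhood. Then any k - 1 disjoint triangles avoiding v, which cover only 3(k - 1) vertices,
  extend by a triangle through v; so the graph without v contains no (k - 1)K3, and the bound
  follows from the induction hypothesis and the trivial bound on the degree of v. Otherwise, a maximal
  family of disjoint triangles has at most 3(k - 1) vertices, and the edges inside the neighbourhood
  of each of them are covered by at most 6(k - 1) vertices. Deleting the edges from each of these
  vertices to its cover destroys all triangles at the cost of 18(k - 1)^2 edges, which is at most
  g_k - g_1 because all parts have size at least 6k^2.\<close>

section \<open>Finite graphs and disjoint families of sets\<close>

lemma finite_edges:
  assumes "simple_graph G"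
  shows "finite (edges G)"
proof (rule finite_subset)
  show "edges G \<subseteq> Pow (verts G)"
    using assms by (auto simp: simple_graph_def)
  show "finite (Pow (verts G))"
    using assms by (simp add: simple_graph_def)
qed

lemma edge_distinct:
  assumes "simple_graph G" "{x, y} \<in> edges G"
  shows "x \<noteq> y"
proof
  assume "x = y"
  with assms have "card {y} = 2"
    by (auto simp: simple_graph_def)
  then show False
    by simp
qed

text \<open>An inclusion-maximal disjoint subfamily works: a nonempty member missing its union could
  still be added. It serves both for triangles and for the edges in a neighbourhood, with
  \<open>\<Union>P\<close> as a hitting set.\<close>

lemma ex_maximal_disjoint_subfamily:
  assumes "finite F" "{} \<notin> F"
  shows "\<exists>P\<subseteq>F. pairwise disjnt P \<and> (\<forall>A\<in>F. A \<inter> \<Union>P \<noteq> {})"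
proof -
  let ?S = "{P \<in> Pow F. pairwise disjnt P}"
  have fin: "finite ?S"
    using assms(1) by simp
  have "{} \<in> ?S"
    by simp
  then have "?S \<noteq> {}"
    by (metis empty_iff)
  from finite_has_maximal[OF fin this]
  obtain P where P: "P \<in> ?S" and max: "\<And>Q. Q \<in> ?S \<Longrightarrow> P \<subseteq> Q \<Longrightarrow> P = Q"
    by auto
  have "A \<inter> \<Union>P \<noteq> {}" if A: "A \<in> F" for A
  proof
    assume dis: "A \<inter> \<Union>P = {}"
    have "\<forall>B\<in>P. disjnt A B \<and> disjnt B A"
      using dis unfolding disjnt_def by blast
    with P A have "insert A P \<in> ?S"
      by (simp add: pairwise_insert)
    then have "P = insert A P"
      by (rule max) blast
    then have "A \<in> P"
      by blast
    with dis have "A = {}"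
      by blast
    with A assms(2) show False
      by blast
  qed
  with P show ?thesis
    by auto
qed

text \<open>Picking a point of \<open>U\<close> from each member is injective, as no point lies in
  two members.\<close>

lemma card_disjoint_family_meeting_le:
  assumes "pairwise disjnt M" "finite U" "\<And>A. A \<in> M \<Longrightarrow> A \<inter> U \<noteq> {}"
  shows "card M \<le> card U"
proof -
  have "\<forall>A\<in>M. \<exists>x. x \<in> A \<inter> U"
    using assms(3) by blast
  then obtain f where f: "\<And>A. A \<in> M \<Longrightarrow> f A \<in> A \<inter> U"
    by metis
  have "inj_on f M"
  proof (rule inj_onI)
    fix A B assume "A \<in> M" "B \<in> M" "f A = f B"
    then have "\<not> disjnt A B"
      using f[of A] f[of B] by (auto simp: disjnt_def)
    with \<open>A \<in> M\<close> \<open>B \<in> M\<close> assms(1) show "A = B"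
      by (meson pairwiseD)
  qed
  then show ?thesis
    using card_inj_on_le[of f M U] f assms(2) by blast
qed

section \<open>Triangles, packings and copies of \<open>kK3\<close>\<close>

text \<open>A triangle is a bare vertex set judged by an edge set alone, so edges can be removed
  without forming a new graph.\<close>

definition is_triangle :: "'a set set \<Rightarrow> 'a set \<Rightarrow> bool" where
  "is_triangle E t \<longleftrightarrow> card t = 3 \<and> (\<forall>x\<in>t. \<forall>y\<in>t. x \<noteq> y \<longrightarrow> {x, y} \<in> E)"

definition triangle_packing :: "'a set set \<Rightarrow> 'a set set \<Rightarrow> bool" where
  "triangle_packing E P \<longleftrightarrow> finite P \<and> pairwise disjnt P \<and> (\<forall>t\<in>P. is_triangle E t)"

lemma is_triangle_mono: "is_triangle E t \<Longrightarrow> E \<subseteq> E' \<Longrightarrow> is_triangle E' t"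
  by (auto simp: is_triangle_def)

lemma triangle_packing_mono: "triangle_packing E P \<Longrightarrow> E \<subseteq> E' \<Longrightarrow> triangle_packing E' P"
  by (auto simp: triangle_packing_def intro: is_triangle_mono)

lemma is_triangle_subset_Union:
  assumes "is_triangle E t"
  shows "t \<subseteq> \<Union>E"
proof
  fix x assume x: "x \<in> t"
  have "t \<noteq> {x}"
    using assms by (auto simp: is_triangle_def)
  with x obtain y where "y \<in> t" "x \<noteq> y"
    by blast
  with assms x have "{x, y} \<in> E"
    by (auto simp: is_triangle_def)
  then show "x \<in> \<Union>E"
    by blast
qed

lemma is_triangleI:
  assumes "{x, y} \<in> E" "{x, z} \<in> E" "{y, z} \<in> E" "x \<noteq> y" "x \<noteq> z" "y \<noteq> z"
  shows "is_triangle E {x, y, z}"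
  using assms by (auto simp: is_triangle_def insert_commute)

lemma finite_Union_triangle_packing: "triangle_packing E P \<Longrightarrow> finite (\<Union>P)"
  unfolding triangle_packing_def is_triangle_def
  by (metis card.infinite finite_Union zero_neq_numeral)

lemma card_Union_triangle_packing:
  assumes "triangle_packing E P"
  shows "card (\<Union>P) = 3 * card P"
proof -
  have "card (\<Union>P) = sum card P"
    using assms by (intro card_Union_disjoint)
      (auto simp: triangle_packing_def is_triangle_def intro: card_ge_0_finite)
  also have "\<dots> = (\<Sum>t\<in>P. 3)"
    using assms by (intro sum.cong) (auto simp: triangle_packing_def is_triangle_def)
  finally show ?thesis
    by simp
qed

text \<open>Turns freeness into the absence of a packing. With \<open>h\<close> numbering the
  triangles and \<open>e t\<close> the vertices of \<open>t\<close>, the embedding sends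
  \<open>(i, a)\<close> to vertex \<open>a\<close> of triangle \<open>i\<close>.\<close>

lemma contains_kK3_if_packing:
  assumes "triangle_packing (edges G) P" "card P = k" "\<Union>(edges G) \<subseteq> verts G"
  shows "contains_copy G (kK3 k)"
proof -
  have fin: "finite P" and dis: "pairwise disjnt P" and tri: "\<And>t. t \<in> P \<Longrightarrow> is_triangle (edges G) t"
    using assms(1) by (auto simp: triangle_packing_def)
  obtain h where h: "bij_betw h {..<k} P"
    using fin assms(2) ex_bij_betw_nat_finite[of P] by (auto simp: atLeast0LessThan)
  have "\<exists>e. bij_betw e {..<3::nat} t" if "t \<in> P" for t
    using tri[OF that] ex_bij_betw_nat_finite[of t]
    by (metis atLeast0LessThan card.infinite is_triangle_def zero_neq_numeral)
  then obtain e where e: "\<And>t. t \<in> P \<Longrightarrow> bij_betw (e t) {..<3::nat} t"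
    by metis
  define f where "f = (\<lambda>(i, a). e (h i) a)"
  have hP: "h i \<in> P" if "i < k" for i
    using h that by (auto simp: bij_betw_def)
  have mem: "e (h i) a \<in> h i" if "i < k" "a < 3" for i a
    using e[OF hP[OF that(1)]] that(2) by (auto simp: bij_betw_def)
  \<comment> \<open>Injectivity of \<open>f\<close>: a common value lies in both triangles, so
    disjointness makes them equal, and \<open>h\<close> and \<open>e (h i)\<close> are
    injective.\<close>
  have eq: "i = j \<and> a = b"
    if "e (h i) a = e (h j) b" "i < k" "j < k" "a < 3" "b < 3" for i j a b
  proof -
    have "\<not> disjnt (h i) (h j)"
      using mem[OF that(2,4)] mem[OF that(3,5)] that(1) by (auto simp: disjnt_def)
    then have "h i = h j"
      using dis hP that by (meson pairwiseD)
    then have "i = j"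
      using h that by (auto simp: bij_betw_def inj_on_def)
    moreover have "a = b"
      using e[OF hP[OF that(2)]] that \<open>i = j\<close> by (auto simp: bij_betw_def inj_on_def)
    ultimately show ?thesis ..
  qed
  show ?thesis
    unfolding contains_copy_def
  proof (intro exI[of _ f] conjI)
    show "inj_on f (verts (kK3 k))"
      using eq by (auto simp: inj_on_def f_def disjoint_copies_def complete_graph_def)
    show "f ` verts (kK3 k) \<subseteq> verts G"
    proof -
      have "h i \<subseteq> verts G" if "i < k" for i
        using is_triangle_subset_Union[OF tri[OF hP[OF that]]] assms(3) by blast
      then show ?thesis
        using mem by (fastforce simp: f_def disjoint_copies_def complete_graph_def)
    qed
    show "\<forall>e\<in>edges (kK3 k). f ` e \<in> edges G"
    proof
      fix d assume "d \<in> edges (kK3 k)"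
      then obtain i a b where d: "d = Pair i ` {a, b}" "i < k" "a < 3" "b < 3" "a \<noteq> b"
        by (auto simp: disjoint_copies_def complete_graph_def)
      then have "e (h i) a \<noteq> e (h i) b"
        using eq by blast
      then show "f ` d \<in> edges G"
        using d tri[OF hP[OF d(2)]] mem[OF d(2)] by (auto simp: f_def is_triangle_def)
    qed
  qed
qed

section \<open>The triangle-free case\<close>

text \<open>A nested sum of indicators, so that it can be merged with sums over
  transversals.\<close>

definition part_edges :: "'a set set \<Rightarrow> 'a set \<Rightarrow> 'a set \<Rightarrow> nat" where
  "part_edges E A B = (\<Sum>x\<in>A. \<Sum>y\<in>B. of_bool ({x, y} \<in> E))"

lemma part_edges_card:
  assumes "finite A" "finite B"
  shows "card {e \<in> E. \<exists>x\<in>A. \<exists>y\<in>B. e = {x, y}} \<le> part_edges E A B"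
proof -
  let ?S = "{p \<in> A \<times> B. {fst p, snd p} \<in> E}"
  have "card {e \<in> E. \<exists>x\<in>A. \<exists>y\<in>B. e = {x, y}} \<le> card ((\<lambda>p. {fst p, snd p}) ` ?S)"
  proof (intro card_mono subsetI)
    fix e assume "e \<in> {e \<in> E. \<exists>x\<in>A. \<exists>y\<in>B. e = {x, y}}"
    then obtain x y where "x \<in> A" "y \<in> B" "e = {x, y}" "e \<in> E"
      by blast
    then show "e \<in> (\<lambda>p. {fst p, snd p}) ` ?S"
      by (intro image_eqI[of _ _ "(x, y)"]) auto
  qed (use assms in auto)
  also have "\<dots> \<le> card ?S"
    using assms by (intro card_image_le) auto
  also have "\<dots> = (\<Sum>p\<in>A \<times> B. of_bool ({fst p, snd p} \<in> E))"
    using assms by (simp add: card_eq_sum sum.inter_filter of_bool_def del: sum_constant One_nat_def)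
  also have "\<dots> = part_edges E A B"
    by (simp add: part_edges_def sum.cartesian_product case_prod_unfold)
  finally show ?thesis .
qed

lemma num_edges_le_part_edges:
  assumes "four_partite G V1 V2 V3 V4"
  shows "num_edges G \<le> part_edges (edges G) V1 V2 + part_edges (edges G) V1 V3
    + part_edges (edges G) V1 V4 + part_edges (edges G) V2 V3
    + part_edges (edges G) V2 V4 + part_edges (edges G) V3 V4"
proof -
  define E where "E = (\<lambda>A B. {e \<in> edges G. \<exists>x\<in>A. \<exists>y\<in>B. e = {x, y}})"
  have fin: "finite V1" "finite V2" "finite V3" "finite V4"
    using assms by (auto simp: four_partite_def simple_graph_def)
  have "edges G \<subseteq> E V1 V2 \<union> E V1 V3 \<union> E V1 V4 \<union> E V2 V3 \<union> E V2 V4 \<union> E V3 V4"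
  proof
    fix e assume e: "e \<in> edges G"
    with assms obtain x y where xy: "e = {x, y}" "x \<in> verts G" "y \<in> verts G"
      by (auto simp: four_partite_def simple_graph_def card_2_iff)
    have "verts G = V1 \<union> V2 \<union> V3 \<union> V4"
      using assms by (simp add: four_partite_def)
    with xy have "x \<in> V1 \<or> x \<in> V2 \<or> x \<in> V3 \<or> x \<in> V4" "y \<in> V1 \<or> y \<in> V2 \<or> y \<in> V3 \<or> y \<in> V4"
      by auto
    moreover from e assms have "\<not> e \<subseteq> V1" "\<not> e \<subseteq> V2" "\<not> e \<subseteq> V3" "\<not> e \<subseteq> V4"
      by (auto simp: four_partite_def)
    then have "\<not> (x \<in> V1 \<and> y \<in> V1)" "\<not> (x \<in> V2 \<and> y \<in> V2)" "\<not> (x \<in> V3 \<and> y \<in> V3)"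
      "\<not> (x \<in> V4 \<and> y \<in> V4)"
      using xy(1) by auto
    moreover have "e \<in> E A B" if "x \<in> A \<and> y \<in> B \<or> y \<in> A \<and> x \<in> B" for A B
      using that e xy(1) unfolding E_def by (auto simp: insert_commute)
    ultimately show "e \<in> E V1 V2 \<union> E V1 V3 \<union> E V1 V4 \<union> E V2 V3 \<union> E V2 V4 \<union> E V3 V4"
      unfolding Un_iff by metis
  qed
  moreover have "finite (E A B)" for A B
    using finite_edges[of G] assms by (simp add: E_def four_partite_def)
  ultimately have "num_edges G
      \<le> card (E V1 V2 \<union> E V1 V3 \<union> E V1 V4 \<union> E V2 V3 \<union> E V2 V4 \<union> E V3 V4)"
    unfolding num_edges_def by (intro card_mono) auto
  also have "\<dots> \<le> card (E V1 V2) + card (E V1 V3) + card (E V1 V4) + card (E V2 V3)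
      + card (E V2 V4) + card (E V3 V4)"
    by (intro order_trans[OF card_Un_le] add_mono order_refl)
  also have "\<dots> \<le> part_edges (edges G) V1 V2 + part_edges (edges G) V1 V3
      + part_edges (edges G) V1 V4 + part_edges (edges G) V2 V3
      + part_edges (edges G) V2 V4 + part_edges (edges G) V3 V4"
    unfolding E_def using fin by (intro add_mono part_edges_card)
  finally show ?thesis .
qed

text \<open>Here \<open>pij\<close> stands for adjacency of vertices \<open>i\<close> and
  \<open>j\<close> of a transversal. A triangle-free graph on four vertices is bipartite, hence lies
  in a star or in a complete bipartite graph with two vertices on each side. For sorted sizes the
  heaviest star is centred at 1 and the heaviest balanced cut is 14|23; their weights are the two
  terms of \<open>g_bound 1\<close>.\<close>

lemma weighted_triangle_free_4:
  fixes n1 n2 n3 n4 :: nat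
  assumes "n1 \<ge> n2" "n2 \<ge> n3" "n3 \<ge> n4"
    and "\<not> (p12 \<and> p13 \<and> p23)" "\<not> (p12 \<and> p14 \<and> p24)" "\<not> (p13 \<and> p14 \<and> p34)"
    and "\<not> (p23 \<and> p24 \<and> p34)"
  shows "n1 * n2 * of_bool p12 + n1 * n3 * of_bool p13 + n1 * n4 * of_bool p14
    + n2 * n3 * of_bool p23 + n2 * n4 * of_bool p24 + n3 * n4 * of_bool p34
    \<le> g_bound 1 n1 n2 n3 n4"
proof -
  obtain a b c where abc: "n3 = n4 + a" "n2 = n3 + b" "n1 = n2 + c"
    using assms(1-3) le_Suc_ex by metis
  \<comment> \<open>Abstract weights keep products out of the case split. The bounds in
    \<open>le\<close> belong to the stars at 1, 2, 3, 4 and the cuts 14|23, 13|24, 12|34, in the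
    order of the seven cases.\<close>
  have cases: "a * of_bool p12 + b * of_bool p13 + c * of_bool p14
      + d * of_bool p23 + e * of_bool p24 + f * of_bool p34 \<le> M"
    if le: "a + b + c \<le> M" "a + d + e \<le> M" "b + d + f \<le> M" "c + e + f \<le> M"
      "a + b + e + f \<le> M" "a + c + d + f \<le> M" "b + c + d + e \<le> M" for a b c d e f M :: nat
  proof -
    have le1: "x * of_bool p \<le> x" for x :: nat and p
      by simp
    have le3: "x * of_bool p + y * of_bool q + z * of_bool r \<le> M" if "x + y + z \<le> M"
      for x y z :: nat and p q r
      by (rule order_trans[OF _ that]) (intro add_mono le1)
    have le4: "x * of_bool p + y * of_bool q + z * of_bool r + w * of_bool s \<le> M"
      if "x + y + z + w \<le> M" for x y z w :: nat and p q r s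
      by (rule order_trans[OF _ that]) (intro add_mono le1)
    consider "\<not> p23" "\<not> p24" "\<not> p34" | "\<not> p13" "\<not> p14" "\<not> p34"
      | "\<not> p12" "\<not> p14" "\<not> p24" | "\<not> p12" "\<not> p13" "\<not> p23"
      | "\<not> p14" "\<not> p23" | "\<not> p13" "\<not> p24" | "\<not> p12" "\<not> p34"
      using assms(4-) by argo
    then show ?thesis
    proof cases
      case 1
      with le3[OF le(1), of p12 p13 p14] show ?thesis by simp
    next
      case 2
      with le3[OF le(2), of p12 p23 p24] show ?thesis by simp
    next
      case 3
      with le3[OF le(3), of p13 p23 p34] show ?thesis by simp
    next
      case 4
      with le3[OF le(4), of p14 p24 p34] show ?thesis by simp
    next
      case 5
      with le4[OF le(5), of p12 p13 p24 p34] show ?thesis by simp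
    next
      case 6
      with le4[OF le(6), of p12 p14 p23 p34] show ?thesis by simp
    next
      case 7
      with le4[OF le(7), of p13 p14 p23 p24] show ?thesis by simp
    qed
  qed
  have g: "n1 * n2 + n1 * n3 + n2 * n4 + n3 * n4 \<le> g_bound 1 n1 n2 n3 n4"
    "n1 * n2 + n1 * n3 + n1 * n4 \<le> g_bound 1 n1 n2 n3 n4"
    by (auto simp: g_bound_def algebra_simps)
  \<comment> \<open>These compare the weights omitted by the three cuts; the differences are
    \<open>(n1 - n2) * (n3 - n4)\<close> and \<open>(n1 - n4) * (n2 - n3)\<close>, so 14|23 omits
    least. The monotonicity facts that follow make the star at 1 the heaviest.\<close>
  have "n1 * n4 + n2 * n3 \<le> n1 * n3 + n2 * n4" "n1 * n3 + n2 * n4 \<le> n1 * n2 + n3 * n4"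
    unfolding abc by (simp_all add: algebra_simps)
  moreover have "n2 * n3 \<le> n1 * n3" "n2 * n4 \<le> n1 * n4" "n3 * n4 \<le> n2 * n4"
    "n2 * n4 \<le> n2 * n3" "n1 * n4 \<le> n1 * n3" "n1 * n3 \<le> n1 * n2"
    using assms(1-3) by (simp_all add: mult_le_mono)
  ultimately show ?thesis
    using g by (intro cases) linarith+
qed

text \<open>Averaging over transversals: each of them spans a triangle-free graph on four vertices, and
  weighting its edge between parts i and j by the product of the two part sizes makes every edge of
  the whole graph count equally often.\<close>

lemma triangle_free_edges_le:
  assumes G: "four_partite G V1 V2 V3 V4"
    and n: "card V1 = n1" "card V2 = n2" "card V3 = n3" "card V4 = n4"
    and sorted: "n1 \<ge> n2" "n2 \<ge> n3" "n3 \<ge> n4" and pos: "n4 > 0"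
    and free: "\<And>t. \<not> is_triangle (edges G) t"
  shows "num_edges G \<le> g_bound 1 n1 n2 n3 n4"
proof -
  let ?E = "edges G"
  let ?a = "\<lambda>x y. of_bool ({x, y} \<in> ?E) :: nat"
  let ?N = "n1 * n2 * n3 * n4"
  have tri: "\<not> ({x, y} \<in> ?E \<and> {x, z} \<in> ?E \<and> {y, z} \<in> ?E)" for x y z
  proof
    assume E: "{x, y} \<in> ?E \<and> {x, z} \<in> ?E \<and> {y, z} \<in> ?E"
    moreover have "simple_graph G"
      using G by (simp add: four_partite_def)
    ultimately have "x \<noteq> y" "x \<noteq> z" "y \<noteq> z"
      using edge_distinct by metis+
    with E free[of "{x, y, z}"] show False
      using is_triangleI[of x y ?E z] by simp
  qed
  have "?N * num_edges G \<le> ?N * (part_edges ?E V1 V2 + part_edges ?E V1 V3 + part_edges ?E V1 V4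
      + part_edges ?E V2 V3 + part_edges ?E V2 V4 + part_edges ?E V3 V4)"
    using num_edges_le_part_edges[OF G] by (rule mult_le_mono2)
  \<comment> \<open>A pair from \<open>V1\<close> and \<open>V2\<close> lies in
    \<open>n3 * n4\<close> transversals, so weight \<open>n1 * n2\<close> counts it
    \<open>?N\<close> times; likewise for the other parts. The positive factor \<open>?N\<close>
    cancels at the end.\<close>
  also have "\<dots> = (\<Sum>x\<in>V1. \<Sum>y\<in>V2. \<Sum>z\<in>V3. \<Sum>w\<in>V4.
      n1 * n2 * ?a x y + n1 * n3 * ?a x z + n1 * n4 * ?a x w
      + n2 * n3 * ?a y z + n2 * n4 * ?a y w + n3 * n4 * ?a z w)"
    unfolding part_edges_def
    by (simp only: sum.distrib sum_distrib_left[symmetric] sum_constant n of_nat_id)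
      (simp only: algebra_simps)
  also have "\<dots> \<le> (\<Sum>x\<in>V1. \<Sum>y\<in>V2. \<Sum>z\<in>V3. \<Sum>w\<in>V4. g_bound 1 n1 n2 n3 n4)"
    by (intro sum_mono weighted_triangle_free_4 sorted tri)
  also have "\<dots> = ?N * g_bound 1 n1 n2 n3 n4"
    by (simp add: n)
  finally show ?thesis
    using sorted pos by simp
qed

section \<open>Links of vertices and the destruction of triangles\<close>

text \<open>The edges spanned by the neighbourhood of \<open>v\<close>. In a simple graph none of
  them contains \<open>v\<close>, since \<open>{v, v}\<close> is a singleton.\<close>

definition link :: "'a set set \<Rightarrow> 'a \<Rightarrow> 'a set set" where
  "link E v = {e \<in> E. \<forall>x\<in>e. {v, x} \<in> E}"

definition del_vertex :: "'a sgraph \<Rightarrow> 'a \<Rightarrow> 'a sgraph" where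
  "del_vertex G v = \<lparr>verts = verts G - {v}, edges = {e \<in> edges G. v \<notin> e}\<rparr>"

lemma is_triangle_insert_link:
  assumes "simple_graph G" "e \<in> link (edges G) v"
  shows "is_triangle (edges G) (insert v e)"
proof -
  have "card e = 2"
    using assms by (simp add: link_def simple_graph_def)
  then obtain x y where "e = {x, y}"
    by (auto simp: card_2_iff)
  with assms(2) have e: "e = {x, y}" "{x, y} \<in> edges G" "{v, x} \<in> edges G" "{v, y} \<in> edges G"
    by (simp_all add: link_def)
  then have "x \<noteq> y" "v \<noteq> x" "v \<noteq> y"
    using edge_distinct[OF assms(1)] by blast+
  then show ?thesis
    using e is_triangleI[of v x "edges G" y] by simp
qed

text \<open>Each of the \<open>3 * m\<close> vertices covered by \<open>Q\<close> lies in at most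
  one edge of the matching \<open>M\<close>, so some edge of \<open>M\<close> is missed and spans a
  new triangle with \<open>v\<close>.\<close>

lemma del_heavy_vertex:
  assumes G: "simple_graph G"
    and M: "M \<subseteq> link (edges G) v" "pairwise disjnt M" "card M > 3 * m"
    and Q: "triangle_packing (edges (del_vertex G v)) Q" "card Q = m"
  shows "\<exists>P. triangle_packing (edges G) P \<and> card P = Suc m"
proof -
  have finQ: "finite Q"
    using Q(1) by (simp add: triangle_packing_def)
  have fin: "finite (\<Union>Q)"
    using Q(1) by (rule finite_Union_triangle_packing)
  have "\<exists>e\<in>M. e \<inter> \<Union>Q = {}"
  proof (rule ccontr)
    assume "\<not> ?thesis"
    then have "card M \<le> card (\<Union>Q)"
      using M(2) fin by (intro card_disjoint_family_meeting_le) auto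
    with card_Union_triangle_packing[OF Q(1)] Q(2) M(3) show False
      by simp
  qed
  then obtain e where e: "e \<in> M" "e \<inter> \<Union>Q = {}" ..
  have "v \<notin> \<Union>Q"
    using is_triangle_subset_Union Q(1) by (fastforce simp: triangle_packing_def del_vertex_def)
  with e have dis: "insert v e \<inter> \<Union>Q = {}"
    by blast
  then have "insert v e \<notin> Q"
    by auto
  moreover have "triangle_packing (edges G) Q"
    using Q(1) by (rule triangle_packing_mono) (auto simp: del_vertex_def)
  moreover have "is_triangle (edges G) (insert v e)"
    using is_triangle_insert_link[OF G] e M(1) by blast
  moreover have "\<forall>t\<in>Q. disjnt (insert v e) t \<and> disjnt t (insert v e)"
    using dis unfolding disjnt_def by blast
  ultimately have "triangle_packing (edges G) (insert (insert v e) Q)"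
    "card (insert (insert v e) Q) = Suc m"
    using Q(2) finQ by (simp_all add: triangle_packing_def pairwise_insert)
  then show ?thesis
    by blast
qed

text \<open>Every triangle has a vertex \<open>v\<close> in a maximal packing, and its side opposite
  \<open>v\<close> lies in the link of \<open>v\<close>. A hitting set of that link contains an end
  \<open>u\<close> of this side, so deleting \<open>{v, u}\<close> destroys the triangle.\<close>

lemma ex_triangle_free_deletion:
  assumes G: "simple_graph G"
    and no_packing: "\<nexists>P. triangle_packing (edges G) P \<and> card P = Suc m"
    and no_heavy: "\<And>v M. M \<subseteq> link (edges G) v \<Longrightarrow> pairwise disjnt M \<Longrightarrow> card M \<le> 3 * m"
  shows "\<exists>D. finite D \<and> card D \<le> 18 * m ^ 2 \<and> (\<forall>t. \<not> is_triangle (edges G - D) t)"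
proof -
  let ?E = "edges G"
  have finV: "finite (verts G)" and E: "\<And>e. e \<in> ?E \<Longrightarrow> e \<subseteq> verts G \<and> card e = 2"
    using G by (auto simp: simple_graph_def)
  have finE: "finite ?E"
    using G by (rule finite_edges)
  have "finite {t. is_triangle ?E t}"
  proof (rule finite_subset)
    show "{t. is_triangle ?E t} \<subseteq> Pow (verts G)"
      using E is_triangle_subset_Union by blast
  qed (simp add: finV)
  moreover have "{} \<notin> {t. is_triangle ?E t}"
    by (simp add: is_triangle_def)
  ultimately obtain P where "P \<subseteq> {t. is_triangle ?E t}" "pairwise disjnt P" "finite P"
    and cover: "\<And>t. is_triangle ?E t \<Longrightarrow> t \<inter> \<Union>P \<noteq> {}"
    using ex_maximal_disjoint_subfamily[of "{t. is_triangle ?E t}"] by (auto dest: finite_subset)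
  then have P: "triangle_packing ?E P"
    by (auto simp: triangle_packing_def)
  \<comment> \<open>A larger packing would contain one of exactly \<open>Suc m\<close>
    triangles.\<close>
  have "card P \<le> m"
  proof (rule ccontr)
    assume "\<not> ?thesis"
    then obtain Q where "Q \<subseteq> P" "card Q = Suc m" "finite Q"
      by (metis not_less_eq_eq obtain_subset_with_card_n)
    moreover from this P have "triangle_packing ?E Q"
      by (auto simp: triangle_packing_def intro: pairwise_subset)
    ultimately show False
      using no_packing by blast
  qed
  then have cardT: "card (\<Union>P) \<le> 3 * m"
    using card_Union_triangle_packing[OF P] by simp
  have finT: "finite (\<Union>P)"
    using P by (rule finite_Union_triangle_packing)
  \<comment> \<open>\<open>C\<close> consists of the vertices of a maximal matching in the link: at
    most \<open>3 * m\<close> edges, two ends each.\<close>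
  have "\<exists>C. finite C \<and> card C \<le> 6 * m \<and> (\<forall>e\<in>link ?E v. e \<inter> C \<noteq> {})" for v
  proof -
    have "finite (link ?E v)" "{} \<notin> link ?E v"
      using finE E by (force simp: link_def)+
    then obtain M where M: "M \<subseteq> link ?E v" "pairwise disjnt M" "\<forall>e\<in>link ?E v. e \<inter> \<Union>M \<noteq> {}"
      using ex_maximal_disjoint_subfamily[of "link ?E v"] by blast
    have c2: "card e = 2" if "e \<in> M" for e
      using that M(1) E by (auto simp: link_def)
    have "card (\<Union>M) \<le> sum card M"
      by (rule card_Union_le_sum_card)
    also have "\<dots> = (\<Sum>e\<in>M. 2)"
      using c2 by (intro sum.cong) auto
    also have "\<dots> \<le> 6 * m"
      using no_heavy[OF M(1,2)] by simp
    finally have "card (\<Union>M) \<le> 6 * m" .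
    moreover have "finite (\<Union>M)"
      using \<open>finite (link ?E v)\<close> M(1) c2
      by (metis card.infinite finite_Union finite_subset zero_neq_numeral)
    ultimately show ?thesis
      using M(3) by blast
  qed
  then obtain C where C: "\<And>v. finite (C v)" "\<And>v. card (C v) \<le> 6 * m"
    "\<And>v e. e \<in> link ?E v \<Longrightarrow> e \<inter> C v \<noteq> {}"
    by metis
  define D where "D = (\<Union>v\<in>\<Union>P. (\<lambda>u. {v, u}) ` C v)"
  have "card D \<le> (\<Sum>v\<in>\<Union>P. card ((\<lambda>u. {v, u}) ` C v))"
    unfolding D_def using finT by (rule card_UN_le)
  also have "\<dots> \<le> (\<Sum>v\<in>\<Union>P. 6 * m)"
    by (intro sum_mono order_trans[OF card_image_le] C)
  also have "\<dots> \<le> 3 * m * (6 * m)"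
    using cardT by (simp del: mult.assoc)
  finally have "card D \<le> 18 * m ^ 2"
    by (simp add: power2_eq_square)
  moreover have "finite D"
    unfolding D_def using finT C(1) by blast
  moreover have False if t: "is_triangle (?E - D) t" for t
  proof -
    from t have tE: "is_triangle ?E t"
      by (rule is_triangle_mono) auto
    then obtain v where v: "v \<in> t" "v \<in> \<Union>P"
      using cover by blast
    have "card (t - {v}) = 2"
      using tE v by (simp add: is_triangle_def)
    then obtain x y where xy: "t - {v} = {x, y}" "x \<noteq> y"
      by (auto simp: card_2_iff)
    then have mem: "x \<in> t" "y \<in> t" "x \<noteq> v" "y \<noteq> v"
      by blast+
    then have "{x, y} \<in> link ?E v"
      using tE v xy unfolding link_def is_triangle_def by (auto simp: insert_commute)
    then obtain u where u: "u \<in> {x, y}" "u \<in> C v"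
      using C(3) by blast
    have "{v, u} \<in> D"
      unfolding D_def using imageI[OF u(2)] by (rule UN_I[OF v(2)])
    moreover have "u \<in> t" "v \<noteq> u"
      using mem u(1) by auto
    with t v(1) have "{v, u} \<in> ?E - D"
      unfolding is_triangle_def by metis
    ultimately show False
      by simp
  qed
  ultimately show ?thesis
    by blast
qed

section \<open>Deleting a vertex while the part sizes stay sorted\<close>

lemma four_partite_swap:
  assumes "four_partite G A B C D"
  shows "four_partite G B A C D" "four_partite G A C B D" "four_partite G A B D C"
  using assms unfolding four_partite_def by (simp_all add: Int_commute Un_ac)

lemma four_partite_del_vertex:
  assumes "four_partite G A B C D"
  shows "four_partite (del_vertex G v) (A - {v}) (B - {v}) (C - {v}) (D - {v})"
  using assms unfolding four_partite_def simple_graph_def del_vertex_def by auto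

text \<open>All neighbours of \<open>v\<close> lie outside its own part.\<close>

lemma num_edges_del_vertex:
  assumes G: "four_partite G A B C D" and V: "V \<in> {A, B, C, D}" and v: "v \<in> V"
  shows "num_edges G \<le> num_edges (del_vertex G v) + card (verts G - V)"
proof -
  have s: "simple_graph G" and fin: "finite (verts G)"
    using G by (auto simp: four_partite_def simple_graph_def)
  have "{e \<in> edges G. v \<in> e} \<subseteq> (\<lambda>u. {v, u}) ` (verts G - V)"
  proof
    fix e assume "e \<in> {e \<in> edges G. v \<in> e}"
    then have e: "e \<in> edges G" "v \<in> e"
      by auto
    then have "card e = 2" "e \<subseteq> verts G" "\<not> e \<subseteq> V"
      using s G V by (auto simp: simple_graph_def four_partite_def)
    then obtain u where "e = {v, u}"
      using e(2) by (auto simp: card_2_iff)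
    then show "e \<in> (\<lambda>u. {v, u}) ` (verts G - V)"
      using \<open>e \<subseteq> verts G\<close> \<open>\<not> e \<subseteq> V\<close> v by blast
  qed
  then have d: "card {e \<in> edges G. v \<in> e} \<le> card (verts G - V)"
    using fin by (meson card_image_le card_mono finite_Diff finite_imageI order_trans)
  have "edges G = edges (del_vertex G v) \<union> {e \<in> edges G. v \<in> e}"
    by (auto simp: del_vertex_def)
  then have "num_edges G \<le> num_edges (del_vertex G v) + card {e \<in> edges G. v \<in> e}"
    unfolding num_edges_def by (metis card_Un_le)
  with d show ?thesis
    by linarith
qed

text \<open>Deleting \<open>v\<close> has to leave the sizes sorted. If the part of \<open>v\<close>
  ties with the next one, the two are exchanged; repeating this moves \<open>v\<close> to the last
  part of its size.\<close>

lemma four_partite_relabel: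
  assumes "four_partite G V1 V2 V3 V4" "v \<in> verts G"
    and "card V1 = n1" "card V2 = n2" "card V3 = n3" "card V4 = n4"
    and "n1 \<ge> n2" "n2 \<ge> n3" "n3 \<ge> n4"
  shows "\<exists>W1 W2 W3 W4. four_partite G W1 W2 W3 W4 \<and>
    card W1 = n1 \<and> card W2 = n2 \<and> card W3 = n3 \<and> card W4 = n4 \<and>
    (v \<in> W1 \<and> n1 > n2 \<or> v \<in> W2 \<and> n2 > n3 \<or> v \<in> W3 \<and> n3 > n4 \<or> v \<in> W4)" (is ?R)
proof -
  \<comment> \<open>The cases run from the last part to the first, since a tie reduces each to the
    one proved just before.\<close>
  have 4: ?R if "four_partite G V1 V2 V3 V4" "v \<in> V4"
    "card V1 = n1" "card V2 = n2" "card V3 = n3" "card V4 = n4" for V1 V2 V3 V4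
    using that by blast
  have 3: ?R if "four_partite G V1 V2 V3 V4" "v \<in> V3"
    "card V1 = n1" "card V2 = n2" "card V3 = n3" "card V4 = n4" for V1 V2 V3 V4
    using 4[of V1 V2 V4 V3] four_partite_swap(3)[OF that(1)] that assms(9)
    by (cases "n3 = n4") (simp, (metis le_neq_implies_less))
  have 2: ?R if "four_partite G V1 V2 V3 V4" "v \<in> V2"
    "card V1 = n1" "card V2 = n2" "card V3 = n3" "card V4 = n4" for V1 V2 V3 V4
    using 3[of V1 V3 V2 V4] four_partite_swap(2)[OF that(1)] that assms(8)
    by (cases "n2 = n3") (simp, (metis le_neq_implies_less))
  have 1: ?R if "four_partite G V1 V2 V3 V4" "v \<in> V1"
    "card V1 = n1" "card V2 = n2" "card V3 = n3" "card V4 = n4" for V1 V2 V3 V4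
    using 2[of V2 V1 V3 V4] four_partite_swap(1)[OF that(1)] that assms(7)
    by (cases "n1 = n2") (simp, (metis le_neq_implies_less))
  have "verts G = V1 \<union> V2 \<union> V3 \<union> V4"
    using assms(1) by (simp add: four_partite_def)
  with assms show ?thesis
    using 1[of V1 V2 V3 V4] 2[of V1 V2 V3 V4] 3[of V1 V2 V3 V4] 4[of V1 V2 V3 V4] by blast
qed

section \<open>Inequalities for \<open>g_bound\<close>\<close>

text \<open>The added sum bounds the degree of a vertex of the shrunken part. Each inequality holds
  for both terms of the maximum separately, with equality when the fourth part shrinks. As
  \<open>m > 0\<close>, the coefficient \<open>k - 1\<close> really grows by one.\<close>

lemma g_bound_del:
  fixes m n1 n2 n3 n4 :: nat
  assumes "n1 \<ge> n2" "n2 \<ge> n3" "n3 \<ge> n4" "n4 > 0" "m > 0"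
  shows "g_bound m (n1 - 1) n2 n3 n4 + (n2 + n3 + n4) \<le> g_bound (Suc m) n1 n2 n3 n4"
    and "g_bound m n1 (n2 - 1) n3 n4 + (n1 + n3 + n4) \<le> g_bound (Suc m) n1 n2 n3 n4"
    and "g_bound m n1 n2 (n3 - 1) n4 + (n1 + n2 + n4) \<le> g_bound (Suc m) n1 n2 n3 n4"
    and "g_bound m n1 n2 n3 (n4 - 1) + (n1 + n2 + n3) \<le> g_bound (Suc m) n1 n2 n3 n4"
proof -
  \<comment> \<open>Writing the sizes as \<open>Suc d\<close> plus gaps and \<open>m\<close> as
    \<open>Suc j\<close> removes all truncated subtraction.\<close>
  from assms obtain a b c where "n3 = n4 + a" "n2 = n3 + b" "n1 = n2 + c"
    using le_Suc_ex by metis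
  moreover from assms obtain d j where "n4 = Suc d" "m = Suc j"
    using gr0_implies_Suc by metis
  ultimately have eq: "n4 = Suc d" "n3 = Suc d + a" "n2 = Suc d + a + b" "n1 = Suc d + a + b + c"
    "m = Suc j"
    by simp_all
  have "max A B + r \<le> max A' B'" if "A + r \<le> A'" "B + r \<le> B'" for A B A' B' r :: nat
    using that by linarith
  note max = this
  show "g_bound m (n1 - 1) n2 n3 n4 + (n2 + n3 + n4) \<le> g_bound (Suc m) n1 n2 n3 n4"
    "g_bound m n1 (n2 - 1) n3 n4 + (n1 + n3 + n4) \<le> g_bound (Suc m) n1 n2 n3 n4"
    "g_bound m n1 n2 (n3 - 1) n4 + (n1 + n2 + n4) \<le> g_bound (Suc m) n1 n2 n3 n4"
    "g_bound m n1 n2 n3 (n4 - 1) + (n1 + n2 + n3) \<le> g_bound (Suc m) n1 n2 n3 n4"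
    unfolding g_bound_def eq by (rule max; simp add: algebra_simps)+
qed

text \<open>The terms of the maximum exceed those for \<open>k = 1\<close> by \<open>m * n1\<close>
  and \<open>m * (n2 + n3)\<close>. The size bound makes both increments large enough to pay for the
  deleted edges.\<close>

lemma g_bound_1_add_le:
  fixes m n1 n2 n3 n4 :: nat
  assumes "n1 \<ge> n2" "n2 \<ge> n3" "n3 \<ge> n4" "n4 \<ge> 6 * (Suc m) ^ 2"
  shows "g_bound 1 n1 n2 n3 n4 + 18 * m ^ 2 \<le> g_bound (Suc m) n1 n2 n3 n4"
proof -
  \<comment> \<open>Equivalent to \<open>m ^ 2 - m + 1 \<ge> 0\<close> over the integers; the
    substitution \<open>m = j + 2\<close> avoids the negative coefficient.\<close>
  have "18 * m \<le> 6 * (Suc m) ^ 2"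
  proof (cases "m \<le> 1")
    case True
    then show ?thesis
      by (cases m) (auto simp: power2_eq_square)
  next
    case False
    then obtain j where "m = j + 2"
      by (metis add.commute le_Suc_ex not_less_eq_eq numeral_2_eq_2 One_nat_def)
    then show ?thesis
      by (simp add: power2_eq_square algebra_simps)
  qed
  with assms have "18 * m \<le> n1" "18 * m \<le> n2 + n3"
    by linarith+
  then have "m * (18 * m) \<le> m * n1" "m * (18 * m) \<le> m * (n2 + n3)"
    by (simp_all only: mult_le_mono2)
  moreover have "m * (18 * m) = 18 * m ^ 2"
    by (simp add: power2_eq_square)
  ultimately have "18 * m ^ 2 \<le> m * n1" "18 * m ^ 2 \<le> m * (n2 + n3)"
    by (simp_all only:)
  then show ?thesis
    unfolding g_bound_def diff_Suc_1 diff_self_eq_0 mult_0 add_0_right by linarith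
qed

section \<open>The induction on the number of triangles\<close>

text \<open>Freeness is expressed by packings, the form in which \<open>del_heavy_vertex\<close>
  passes it to \<open>del_vertex G v\<close> with \<open>k\<close> lowered by one.\<close>

lemma edges_le_g_bound:
  assumes "k \<ge> 1" "four_partite G V1 V2 V3 V4"
    and "card V1 = n1" "card V2 = n2" "card V3 = n3" "card V4 = n4"
    and "n1 \<ge> n2" "n2 \<ge> n3" "n3 \<ge> n4" "n4 \<ge> 6 * k ^ 2"
    and "\<nexists>P. triangle_packing (edges G) P \<and> card P = k"
  shows "num_edges G \<le> g_bound k n1 n2 n3 n4"
  using assms
proof (induction k arbitrary: G V1 V2 V3 V4 n1 n2 n3 n4)
  case 0
  then show ?case
    by simp
next
  case (Suc m)
  note G = Suc.prems(2) and n = Suc.prems(3-6) and sorted = Suc.prems(7-9)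
  have sG: "simple_graph G"
    using G by (simp add: four_partite_def)
  \<comment> \<open>The surplus of \<open>6 * (Suc m) ^ 2\<close> lets the smallest part lose a
    vertex in the induction step, and makes \<open>n4\<close> positive.\<close>
  have big: "n4 \<ge> 6 * m ^ 2 + 1"
    using Suc.prems(10) by (simp add: power2_eq_square)
  show ?case
  proof (cases "\<exists>v M. M \<subseteq> link (edges G) v \<and> pairwise disjnt M \<and> card M > 3 * m")
    case False
    then have light: "\<And>v M. M \<subseteq> link (edges G) v \<Longrightarrow> pairwise disjnt M \<Longrightarrow> card M \<le> 3 * m"
      by (meson not_le)
    have "\<exists>D. finite D \<and> card D \<le> 18 * m ^ 2 \<and> (\<forall>t. \<not> is_triangle (edges G - D) t)"
      using sG Suc.prems(11) light by (rule ex_triangle_free_deletion)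
    then obtain D where D: "finite D" "card D \<le> 18 * m ^ 2" "\<And>t. \<not> is_triangle (edges G - D) t"
      by blast
    let ?H = "\<lparr>verts = verts G, edges = edges G - D\<rparr>"
    have "num_edges ?H \<le> g_bound 1 n1 n2 n3 n4"
    proof (rule triangle_free_edges_le)
      show "four_partite ?H V1 V2 V3 V4"
        using G unfolding four_partite_def simple_graph_def by auto
      show "\<not> is_triangle (edges ?H) t" for t
        using D(3) by simp
    qed (use n sorted big in simp_all)
    moreover have "num_edges G \<le> num_edges ?H + card D"
      using diff_card_le_card_Diff[OF D(1), of "edges G"] by (simp add: num_edges_def le_diff_conv)
    ultimately show ?thesis
      using D(2) g_bound_1_add_le[OF sorted Suc.prems(10)] by linarith
  next
    case True
    then obtain v M where M: "M \<subseteq> link (edges G) v" "pairwise disjnt M" "card M > 3 * m"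
      by blast
    let ?H = "del_vertex G v"
    have no_packing: "\<nexists>P. triangle_packing (edges ?H) P \<and> card P = m"
      using del_heavy_vertex[OF sG M] Suc.prems(11) by blast
    \<comment> \<open>The empty packing rules out \<open>m = 0\<close>, where the induction
      hypothesis says nothing.\<close>
    have "triangle_packing (edges ?H) {}"
      by (simp add: triangle_packing_def)
    with no_packing have m: "m \<ge> 1"
      by (metis card.empty less_one not_le)
    \<comment> \<open>So far \<open>v\<close> is any element of the type; as \<open>M\<close> is
      nonempty, \<open>v\<close> lies in a triangle and hence in \<open>G\<close>.\<close>
    from M(3) obtain e where e: "e \<in> link (edges G) v"
      using M(1) by fastforce
    have "v \<in> verts G"
      using is_triangle_subset_Union[OF is_triangle_insert_link[OF sG e]] sG
      by (auto simp: simple_graph_def)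
    from four_partite_relabel[OF G this n sorted] obtain W1 W2 W3 W4
      where W: "four_partite G W1 W2 W3 W4"
      and c: "card W1 = n1" "card W2 = n2" "card W3 = n3" "card W4 = n4"
      and v: "v \<in> W1 \<and> n1 > n2 \<or> v \<in> W2 \<and> n2 > n3 \<or> v \<in> W3 \<and> n3 > n4 \<or> v \<in> W4"
      by blast
    have fin: "finite W1" "finite W2" "finite W3" "finite W4"
      using W by (auto simp: four_partite_def simple_graph_def)
    have vs: "verts G = W1 \<union> W2 \<union> W3 \<union> W4" and dis: "W1 \<inter> W2 = {}" "W1 \<inter> W3 = {}"
      "W1 \<inter> W4 = {}" "W2 \<inter> W3 = {}" "W2 \<inter> W4 = {}" "W3 \<inter> W4 = {}"
      using W by (simp_all add: four_partite_def)
    have "card (verts G) = n1 + n2 + n3 + n4"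
      unfolding vs using fin dis c by (simp add: card_Un_disjoint Int_Un_distrib2)
    moreover have "W1 \<subseteq> verts G" "W2 \<subseteq> verts G" "W3 \<subseteq> verts G" "W4 \<subseteq> verts G"
      using vs by auto
    ultimately have deg: "card (verts G - W1) = n2 + n3 + n4" "card (verts G - W2) = n1 + n3 + n4"
      "card (verts G - W3) = n1 + n2 + n4" "card (verts G - W4) = n1 + n2 + n3"
      using fin c by (simp_all add: card_Diff_subset)
    \<comment> \<open>Only the part of \<open>v\<close> shrinks, so each case below lowers one size
      by one; the strict inequality from the relabelling keeps the order in the first three
      cases.\<close>
    have IH: "num_edges ?H \<le> g_bound m a b c d"
      if "card (W1 - {v}) = a" "card (W2 - {v}) = b" "card (W3 - {v}) = c" "card (W4 - {v}) = d"
        "a \<ge> b" "b \<ge> c" "c \<ge> d" "d \<ge> 6 * m ^ 2" for a b c d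
      using m four_partite_del_vertex[OF W] that no_packing by (rule Suc.IH)
    have del: "num_edges G \<le> num_edges ?H + card (verts G - V)" if "V \<in> {W1, W2, W3, W4}" "v \<in> V" for V
      using W that by (rule num_edges_del_vertex)
    have "n4 > 0" "m > 0"
      using big m by simp_all
    note gb = g_bound_del[OF sorted this]
    from v show ?thesis
    proof (elim disjE conjE)
      assume "v \<in> W1" "n1 > n2"
      moreover from this have "v \<notin> W2" "v \<notin> W3" "v \<notin> W4"
        using dis by blast+
      ultimately have "num_edges ?H \<le> g_bound m (n1 - 1) n2 n3 n4"
        using c fin sorted big by (intro IH) simp_all
      then show ?thesis
        using del[of W1] \<open>v \<in> W1\<close> deg(1) gb(1) by simp
    next
      assume "v \<in> W2" "n2 > n3"
      moreover from this have "v \<notin> W1" "v \<notin> W3" "v \<notin> W4"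
        using dis by blast+
      ultimately have "num_edges ?H \<le> g_bound m n1 (n2 - 1) n3 n4"
        using c fin sorted big by (intro IH) simp_all
      then show ?thesis
        using del[of W2] \<open>v \<in> W2\<close> deg(2) gb(2) by simp
    next
      assume "v \<in> W3" "n3 > n4"
      moreover from this have "v \<notin> W1" "v \<notin> W2" "v \<notin> W4"
        using dis by blast+
      ultimately have "num_edges ?H \<le> g_bound m n1 n2 (n3 - 1) n4"
        using c fin sorted big by (intro IH) simp_all
      then show ?thesis
        using del[of W3] \<open>v \<in> W3\<close> deg(3) gb(3) by simp
    next
      assume "v \<in> W4"
      moreover from this have "v \<notin> W1" "v \<notin> W2" "v \<notin> W3"
        using dis by blast+
      ultimately have "num_edges ?H \<le> g_bound m n1 n2 n3 (n4 - 1)"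
        using c fin sorted big by (intro IH) simp_all
      then show ?thesis
        using del[of W4] \<open>v \<in> W4\<close> deg(4) gb(4) by simp
    qed
  qed
qed

section \<open>The extremal number of the complete four-partite graph\<close>

text \<open>A subgraph may miss vertices, so its edges are placed on the full vertex set to get
  parts of the prescribed sizes.\<close>

lemma four_partite_complete_multipartite_subgraph:
  assumes "E \<subseteq> edges (complete_multipartite [n1, n2, n3, n4])"
  shows "four_partite \<lparr>verts = verts (complete_multipartite [n1, n2, n3, n4]), edges = E\<rparr>
    ({0} \<times> {..<n1}) ({1} \<times> {..<n2}) ({2} \<times> {..<n3}) ({3} \<times> {..<n4})"
proof -
  let ?V = "verts (complete_multipartite [n1, n2, n3, n4])"
  have V: "?V = {0} \<times> {..<n1} \<union> {1} \<times> {..<n2} \<union> {2} \<times> {..<n3} \<union> {3} \<times> {..<n4}"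
    by (auto simp: complete_multipartite_def less_Suc_eq numeral_2_eq_2 numeral_3_eq_3)
  have E: "e \<subseteq> ?V \<and> card e = 2 \<and> (\<forall>i. \<not> e \<subseteq> {i} \<times> UNIV)" if e: "e \<in> E" for e
  proof -
    have "e \<in> edges (complete_multipartite [n1, n2, n3, n4])"
      using assms e by blast
    then show ?thesis
      by (auto simp: complete_multipartite_def)
  qed
  have "\<not> e \<subseteq> {i} \<times> A" if "e \<in> E" for e i A
    using E[OF that] by blast
  then show ?thesis
    using E by (auto simp: four_partite_def simple_graph_def V)
qed

theorem theorem1p3:
  fixes k :: nat
  assumes "k \<ge> 1"
  shows "\<exists>N0::nat. \<forall>n1 n2 n3 n4 :: nat.
    n1 \<ge> n2 \<and> n2 \<ge> n3 \<and> n3 \<ge> n4 \<and> n4 \<ge> 6 * k^2 \<and> n1 + n2 + n3 + n4 \<ge> N0 \<longrightarrow>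
      (\<forall>(G :: 'a sgraph) V1 V2 V3 V4.
         four_partite G V1 V2 V3 V4 \<and>
         card V1 = n1 \<and> card V2 = n2 \<and> card V3 = n3 \<and> card V4 = n4 \<and>
         is_free (kK3 k) G \<longrightarrow> num_edges G \<le> g_bound k n1 n2 n3 n4) \<and>
      ex_num (complete_multipartite [n1, n2, n3, n4]) (kK3 k) \<le> g_bound k n1 n2 n3 n4"
\<comment> \<open>The witness \<open>0\<close> works since \<open>n4 \<ge> 6 * k^2\<close> supplies
  the largeness that \<open>edges_le_g_bound\<close> asks for.\<close>
proof (intro exI[of _ 0] allI impI conjI; elim conjE)
  fix n1 n2 n3 n4 :: nat and G :: "'a sgraph" and V1 V2 V3 V4
  assume sizes: "n2 \<le> n1" "n3 \<le> n2" "n4 \<le> n3" "6 * k^2 \<le> n4"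
    and G: "four_partite G V1 V2 V3 V4" and free: "is_free (kK3 k) G"
    and c: "card V1 = n1" "card V2 = n2" "card V3 = n3" "card V4 = n4"
  have "\<Union>(edges G) \<subseteq> verts G"
    using G by (auto simp: four_partite_def simple_graph_def)
  then have "\<nexists>P. triangle_packing (edges G) P \<and> card P = k"
    using free contains_kK3_if_packing[of G] unfolding is_free_def by blast
  then show "num_edges G \<le> g_bound k n1 n2 n3 n4"
    using edges_le_g_bound[OF assms G c sizes] by blast
next
  fix n1 n2 n3 n4 :: nat
  assume sizes: "n2 \<le> n1" "n3 \<le> n2" "n4 \<le> n3" "6 * k^2 \<le> n4"
  let ?H = "complete_multipartite [n1, n2, n3, n4]"
  let ?S = "{num_edges G | G. subgraph G ?H \<and> is_free (kK3 k) G}"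
  have bound: "num_edges G \<le> g_bound k n1 n2 n3 n4"
    if sub: "subgraph G ?H" and free: "is_free (kK3 k) G" for G
  proof -
    \<comment> \<open>Packings depend on the edges alone, so enlarging the vertex set creates
      none.\<close>
    let ?G = "\<lparr>verts = verts ?H, edges = edges G\<rparr>"
    have "\<Union>(edges G) \<subseteq> verts G"
      using sub by (auto simp: subgraph_def simple_graph_def)
    then have "\<nexists>P. triangle_packing (edges G) P \<and> card P = k"
      using free contains_kK3_if_packing[of G] unfolding is_free_def by blast
    moreover have "four_partite ?G
        ({0} \<times> {..<n1}) ({1} \<times> {..<n2}) ({2} \<times> {..<n3}) ({3} \<times> {..<n4})"
      using sub by (intro four_partite_complete_multipartite_subgraph) (simp add: subgraph_def)
    ultimately have "num_edges ?G \<le> g_bound k n1 n2 n3 n4"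
      using sizes by (intro edges_le_g_bound[OF assms]) (auto simp: card_cartesian_product)
    then show ?thesis
      by (simp add: num_edges_def)
  qed
  \<comment> \<open>The empty graph is free because \<open>kK3 k\<close> has a vertex for
    \<open>k \<ge> 1\<close>. Hence \<open>?S\<close> is nonempty and, being bounded, contains its
    \<open>Max\<close>.\<close>
  have "subgraph \<lparr>verts = {}, edges = {}\<rparr> ?H"
    by (simp add: subgraph_def simple_graph_def)
  moreover have "is_free (kK3 k) \<lparr>verts = {}, edges = {}\<rparr>"
    using assms by (simp add: is_free_def contains_copy_def disjoint_copies_def complete_graph_def
        lessThan_empty_iff)
  ultimately have "?S \<noteq> {}"
    by blast
  moreover have "?S \<subseteq> {..g_bound k n1 n2 n3 n4}"
    using bound by blast
  moreover from this have "finite ?S"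
    using finite_atMost by (rule finite_subset)
  ultimately have "Max ?S \<in> {..g_bound k n1 n2 n3 n4}"
    using Max_in by blast
  then show "ex_num ?H (kK3 k) \<le> g_bound k n1 n2 n3 n4"
    unfolding ex_num_def by (simp only: atMost_iff)
qed

end
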